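(* Let $V$ be a finite-dimensional real vector space with norm $\|\cdot\|$, dual space $V^*$ and dual norm $\|\cdot\|_*$. Let $K \subseteq V$ be a non-empty bounded closed convex set with diameter $D = \sup_{x,y \in K}\|x-y\|$. Let $\lambda>0$ and let $R:K\to\mathbb{R}$ be a non-negative lower semi-continuous function that is $\lambda$-strongly convex with respect to $\|\cdot\|$ and bounded from above. Then for every sequence of loss vectors $\ell_1,\ell_2,\dots \in V^*$, every integer $T\ge 0$ and every $u\in K$, the regret of the AdaFTRL algorithm with regularizer $R$ satisfies $$\mathrm{Regret}_T(u) \le \sqrt{3}\,\max\left\{D, \frac{1}{\sqrt{2\lambda}}\right\}\sqrt{\sum_{t=1}^T \|\ell_t\|_*^2}\;\bigl(1+R(u)\bigr).$$
   Context: Online linear optimization: in each round $t=1,2,\dots$ an algorithm chooses $w_t\in K$ (depending only on $\ell_1,\dots,\ell_{t-1}$), then observes $\ell_t\in V^*$. For $u\in K$, $\mathrm{Regret}_T(u)=\sum_{t=1}^T\langle \ell_t,w_t\rangle-\sum_{t=1}^T\langle \ell_t,u\rangle$, where $\langle\cdot,\cdot\rangle:V^*\times V\to\mathbb{R}$ is the duality pairing. Strong convexity: a convex function $f:K\to\mathbb{R}$ is $\lambda$-strongly convex with respect to $\|\cdot\|$ if $f(y)\ge f(x)+\langle g,y-x\rangle+\frac{\lambda}{2}\|x-y\|^2$ for all $x,y\in K$ and every subgradient $g\in V^*$ of $f$ at $x$. Fenchel conjugate: $R^*(\ell)=\sup_{w\in K}(\langle \ell,w\rangle-R(w))$ for $\ell\in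 V^*$; under the stated hypotheses it is finite and differentiable on $V^*$, with $\nabla R^*(\ell)=\arg\min_{w\in K}(R(w)-\langle \ell,w\rangle)$. Bregman divergence: $\mathcal{B}_{R^*}(x,y)=R^*(x)-R^*(y)-\langle x-y,\nabla R^*(y)\rangle$. AdaFTRL with regularizer $R$: let $L_t=\sum_{s=1}^t\ell_s$ (so $L_0=0$). Define $\Delta_0=0$ and, for $t\ge1$, $$\Delta_t=\sum_{i=1}^t \Delta_{i-1}\,\mathcal{B}_{R^*}\!\left(-\frac{L_i}{\Delta_{i-1}},-\frac{L_{i-1}}{\Delta_{i-1}}\right),$$ where, if $\Delta_{i-1}=0$, the $i$-th summand is defined as $\lim_{a\to0^+}a\,\mathcal{B}_{R^*}(-L_i/a,-L_{i-1}/a)$ (this limit exists and is finite). In round $t$ the algorithm predicts $w_t=\arg\min_{w\in K}\left(\langle L_{t-1},w\rangle+\Delta_{t-1}R(w)\right)$; when $\Delta_{t-1}=0$, $w_t$ is the minimizer of $\langle L_{t-1},w\rangle$ over $w\in K$ having the smallest value of $R(w)$ (unique by strong convexity), equivalently $w_t=\lim_{a\to0^+}\arg\min_{w\in K}(\langle L_{t-1},w\rangle+aR(w))$. *)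

theory Defs
  imports "HOL-Analysis.Analysis"
begin

text \<open>The dual space \<open>V\<^sup>*\<close> of a finite-dimensional normed space \<open>V\<close>, modelled by the type
  \<open>'v\<close>, is the type \<open>'v \<Rightarrow>\<^sub>L real\<close> of bounded linear functionals: every linear functional is
  bounded in finite dimension, and the norm of this type is the dual norm. A real function on
  \<open>K\<close> is a total function on \<open>'v\<close> whose values outside \<open>K\<close> are never used.\<close>

definition finite_dimensional :: "'v::real_vector itself \<Rightarrow> bool" where
  "finite_dimensional _ \<longleftrightarrow> (\<exists>B :: 'v set. finite B \<and> span B = UNIV)"

definition lower_semicontinuous_on :: "'v::topological_space set \<Rightarrow> ('v \<Rightarrow> real) \<Rightarrow> bool" where
  "lower_semicontinuous_on K f \<longleftrightarrow>
     (\<forall>x\<in>K. \<forall>c. c < f x \<longrightarrow> (\<forall>\<^sub>F y in at x within K. c < f y))"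

definition is_subgradient ::
  "'v::real_normed_vector set \<Rightarrow> ('v \<Rightarrow> real) \<Rightarrow> 'v \<Rightarrow> ('v \<Rightarrow>\<^sub>L real) \<Rightarrow> bool" where
  "is_subgradient K f x g \<longleftrightarrow> (\<forall>z\<in>K. f z \<ge> f x + blinfun_apply g (z - x))"

definition strongly_convex_on ::
  "real \<Rightarrow> 'v::real_normed_vector set \<Rightarrow> ('v \<Rightarrow> real) \<Rightarrow> bool" where
  "strongly_convex_on lam K f \<longleftrightarrow>
     convex_on K f \<and>
     (\<forall>x\<in>K. \<forall>y\<in>K. \<forall>g. is_subgradient K f x g \<longrightarrow>
        f y \<ge> f x + blinfun_apply g (y - x) + lam / 2 * (norm (x - y))\<^sup>2)"

definition fenchel_conjugate ::
  "'v::real_normed_vector set \<Rightarrow> ('v \<Rightarrow> real) \<Rightarrow> ('v \<Rightarrow>\<^sub>L real) \<Rightarrow> real" where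
  "fenchel_conjugate K R l = (SUP w\<in>K. blinfun_apply l w - R w)"

text \<open>The pairing of \<open>x - y\<close> with the gradient of \<open>F\<close> at \<open>y\<close> is the Frechet derivative
  of \<open>F\<close> at \<open>y\<close> in direction \<open>x - y\<close>.\<close>

definition bregman :: "('b::real_normed_vector \<Rightarrow> real) \<Rightarrow> 'b \<Rightarrow> 'b \<Rightarrow> real" where
  "bregman F x y = F x - F y - frechet_derivative F (at y) (x - y)"

text \<open>Losses are indexed from 1; the value \<open>l 0\<close> is never used.\<close>

definition cum_loss :: "(nat \<Rightarrow> 'b::real_normed_vector) \<Rightarrow> nat \<Rightarrow> 'b" where
  "cum_loss l t = (\<Sum>s\<in>{1..t}. l s)"

text \<open>\<open>scaled_bregman F a x y\<close> is \<open>a\<close> times the divergence of \<open>- x / a\<close> from \<open>- y / a\<close>,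
  extended to \<open>a = 0\<close> by its limit from the right.\<close>

definition scaled_bregman ::
  "('b::real_normed_vector \<Rightarrow> real) \<Rightarrow> real \<Rightarrow> 'b \<Rightarrow> 'b \<Rightarrow> real" where
  "scaled_bregman F a x y =
     (if a = 0 then Lim (at_right 0) (\<lambda>b. b * bregman F (- (x /\<^sub>R b)) (- (y /\<^sub>R b)))
      else a * bregman F (- (x /\<^sub>R a)) (- (y /\<^sub>R a)))"

function ada_delta ::
  "'v::real_normed_vector set \<Rightarrow> ('v \<Rightarrow> real) \<Rightarrow> (nat \<Rightarrow> 'v \<Rightarrow>\<^sub>L real) \<Rightarrow> nat \<Rightarrow> real" where
  "ada_delta K R l t =
     (\<Sum>i\<in>{1..t}. scaled_bregman (fenchel_conjugate K R) (ada_delta K R l (i - 1))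
        (cum_loss l i) (cum_loss l (i - 1)))"
  by pat_completeness auto
termination
  by (relation "Wellfounded.measure (\<lambda>(K, R, l, t). t)") auto

declare ada_delta.simps [simp del]

text \<open>If the coefficient is 0, the prediction is, among the minimizers of \<open>L\<close> over \<open>K\<close>,
  the one with the smallest value of \<open>R\<close>.\<close>

definition ftrl_prediction ::
  "'v::real_normed_vector set \<Rightarrow> ('v \<Rightarrow> real) \<Rightarrow> real \<Rightarrow> ('v \<Rightarrow>\<^sub>L real) \<Rightarrow> 'v" where
  "ftrl_prediction K R a L =
     (if a = 0 then arg_min_on R {w. is_arg_min (blinfun_apply L) (\<lambda>v. v \<in> K) w}
      else arg_min_on (\<lambda>w. blinfun_apply L w + a * R w) K)"

definition adaftrl ::
  "'v::real_normed_vector set \<Rightarrow> ('v \<Rightarrow> real) \<Rightarrow> (nat \<Rightarrow> 'v \<Rightarrow>\<^sub>L real) \<Rightarrow> nat \<Rightarrow> 'v" where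
  "adaftrl K R l t = ftrl_prediction K R (ada_delta K R l (t - 1)) (cum_loss l (t - 1))"

definition regret ::
  "(nat \<Rightarrow> 'v::real_normed_vector \<Rightarrow>\<^sub>L real) \<Rightarrow> (nat \<Rightarrow> 'v) \<Rightarrow> nat \<Rightarrow> 'v \<Rightarrow> real" where
  "regret l w T u =
     (\<Sum>t\<in>{1..T}. blinfun_apply (l t) (w t)) - (\<Sum>t\<in>{1..T}. blinfun_apply (l t) u)"

end

theory Submission
  imports Defs
begin

text \<open>A minimizer \<open>w\<close> of \<open>L + a R\<close> over \<open>K\<close> with \<open>a > 0\<close> has \<open>- L / a\<close> as a subgradient of \<open>R\<close>,
  so strong convexity applies at \<open>w\<close>; this makes the conjugate smooth with gradient \<open>w\<close>.
  With \<open>G a L\<close> the minimum of \<open>L + a R\<close> over \<open>K\<close>, the increment of \<open>\<Delta>\<close> in round \<open>t\<close> equals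
  \<open>G \<Delta> L\<^sub>t\<^sub>-\<^sub>1 - G \<Delta> L\<^sub>t + \<langle>\<ell>\<^sub>t, w\<^sub>t\<rangle>\<close> for \<open>\<Delta> = \<Delta>\<^sub>t\<^sub>-\<^sub>1\<close>, also in the limiting case
  \<open>\<Delta> = 0\<close>. Telescoping, with \<open>G\<close> monotone in its first argument, bounds the regret by
  \<open>\<Delta>\<^sub>T (1 + R u)\<close>. An increment \<open>\<delta>\<close> satisfies \<open>\<delta> \<le> D \<parallel>\<ell>\<^sub>t\<parallel>\<close> and
  \<open>\<Delta> \<delta> \<le> \<parallel>\<ell>\<^sub>t\<parallel>\<^sup>2 / (2 \<lambda>)\<close>, so \<open>\<Delta>\<^sup>2\<close> grows by at most
  \<open>2 \<Delta> \<delta> + \<delta>\<^sup>2 \<le> 3 max (D\<^sup>2) (1 / (2 \<lambda>)) \<parallel>\<ell>\<^sub>t\<parallel>\<^sup>2\<close> per round.\<close>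

section \<open>Compactness in finite-dimensional normed spaces\<close>

lemma closed_span_if_compact_balls:
  fixes B :: "'v::real_normed_vector set"
  assumes "\<And>r. compact (cball 0 r \<inter> span B)"
  shows "closed (span B)"
  unfolding closed_sequential_limits
proof (intro allI impI)
  fix x :: "nat \<Rightarrow> 'v" and l
  assume x: "(\<forall>n. x n \<in> span B) \<and> x \<longlonglongrightarrow> l"
  then have "Bseq x"
    using convergent_imp_Bseq convergentI by blast
  then obtain r where "\<And>n. norm (x n) \<le> r"
    unfolding Bseq_def by blast
  then have "\<forall>n. x n \<in> cball 0 r \<inter> span B"
    using x by auto
  then have "l \<in> cball 0 r \<inter> span B"
    using compact_imp_closed[OF assms[of r]] x unfolding closed_sequential_limits by blast
  then show "l \<in> span B" by simp
qed

text \<open>Adding a vector \<open>a\<close> outside the closed set \<open>span B\<close> leaves a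
  positive distance \<open>d\<close> between them, which bounds the coefficient of \<open>a\<close>
  in any vector of the ball. The radius varies in the induction because the remaining component in
  \<open>span B\<close> may be longer than \<open>r\<close>.\<close>

lemma compact_cball_Int_span:
  fixes B :: "'v::real_normed_vector set"
  assumes "finite B"
  shows "compact (cball 0 r \<inter> span B)"
  using assms
proof (induction B arbitrary: r rule: finite_induct)
  case empty
  have "compact (cball 0 r \<inter> {0 :: 'v})"
    by (intro finite_imp_compact) simp
  then show ?case by simp
next
  case (insert a B)
  show ?case
  proof (cases "a \<in> span B")
    case True
    then show ?thesis using insert.IH by (simp add: span_redundant)
  next
    case False
    define d where "d = infdist a (span B)"
    have "closed (span B)"
      using insert.IH by (rule closed_span_if_compact_balls)
    then have d: "d > 0"
      using False span_zero[of B] in_closed_iff_infdist_zero[of "span B" a] infdist_nonneg[of a "span B"]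
      unfolding d_def by (metis empty_iff order_less_le)
    \<comment> \<open>With \<open>\<bar>k\<bar> \<le> r / d\<close>, this bounds
      \<open>v - k *\<^sub>R a\<close> by the triangle inequality.\<close>
    define r' where "r' = r + r / d * norm a"
    define S where "S = (\<lambda>(k, x). k *\<^sub>R a + x) ` ({- (r / d)..r / d} \<times> (cball 0 r' \<inter> span B))"
    have "compact S"
      unfolding S_def case_prod_beta
      by (intro compact_continuous_image compact_Times insert.IH compact_Icc continuous_intros)
    moreover have "S \<subseteq> span (insert a B)"
      unfolding S_def
      by (auto intro!: span_add span_scale intro: span_base span_mono[THEN subsetD, of B])
    moreover have "v \<in> S" if v: "norm v \<le> r" "v \<in> span (insert a B)" for v
    proof -
      obtain k where k: "v - k *\<^sub>R a \<in> span B"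
        using v(2) by (auto simp: span_insert)
      have "\<bar>k\<bar> * d \<le> norm v"
      proof (cases "k = 0")
        case False
        \<comment> \<open>This point of \<open>span B\<close> is \<open>a - v / k\<close>, at
          distance \<open>norm v / \<bar>k\<bar>\<close> from \<open>a\<close>.\<close>
        have "- (inverse k *\<^sub>R (v - k *\<^sub>R a)) \<in> span B"
          using k by (intro span_neg span_scale)
        then have "d \<le> dist a (- (inverse k *\<^sub>R (v - k *\<^sub>R a)))"
          unfolding d_def by (rule infdist_le)
        also have "\<dots> = norm (inverse k *\<^sub>R v)"
          using False by (simp add: dist_norm algebra_simps)
        finally show ?thesis using False by (simp add: field_simps)
      qed simp
      then have kd: "\<bar>k\<bar> \<le> r / d"
        using d v(1) by (simp add: field_simps)
      have "norm (v - k *\<^sub>R a) \<le> norm v + \<bar>k\<bar> * norm a"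
        using norm_triangle_ineq4[of v "k *\<^sub>R a"] by simp
      also have "\<dots> \<le> r'"
        unfolding r'_def using v(1) kd by (intro add_mono mult_right_mono) auto
      finally show ?thesis
        unfolding S_def using kd k by (intro image_eqI[of _ _ "(k, v - k *\<^sub>R a)"]) auto
    qed
    ultimately have "cball 0 r \<inter> span (insert a B) = cball 0 r \<inter> S" by auto
    then show ?thesis
      using \<open>compact S\<close> by (simp add: closed_Int_compact)
  qed
qed

lemma finite_dimensional_compact:
  fixes K :: "'v::real_normed_vector set"
  assumes "finite_dimensional TYPE('v)" "bounded K" "closed K"
  shows "compact K"
proof -
  obtain B :: "'v set" where B: "finite B" "span B = UNIV"
    using assms(1) unfolding finite_dimensional_def by blast
  obtain r where "\<forall>x\<in>K. norm x \<le> r"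
    using assms(2) unfolding bounded_iff by blast
  then have "K = K \<inter> (cball 0 r \<inter> span B)"
    using B by auto
  then show ?thesis
    using closed_Int_compact[OF assms(3) compact_cball_Int_span[OF B(1), of r]] by simp
qed

section \<open>Lower semicontinuous functions\<close>

lemma lower_semicontinuous_on_subset:
  assumes "lower_semicontinuous_on K f" "F \<subseteq> K"
  shows "lower_semicontinuous_on F f"
  unfolding lower_semicontinuous_on_def
proof (intro ballI allI impI)
  fix x c assume "x \<in> F" "c < f x"
  then have "\<forall>\<^sub>F y in at x within K. c < f y"
    using assms unfolding lower_semicontinuous_on_def by auto
  then show "\<forall>\<^sub>F y in at x within F. c < f y"
    by (rule filter_leD[OF at_le[OF assms(2)]])
qed

text \<open>Without a minimum the relatively open sets \<open>?U y\<close> would cover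
  \<open>K\<close>. In a finite subcover, the index with the least value of \<open>f\<close> lies in
  none of the chosen sets.\<close>

lemma lower_semicontinuous_on_attains_min:
  assumes "lower_semicontinuous_on K f" "compact K" "K \<noteq> {}"
  shows "\<exists>x\<in>K. \<forall>y\<in>K. f x \<le> f y"
proof (rule ccontr)
  assume "\<not> ?thesis"
  then have cover: "\<And>x. x \<in> K \<Longrightarrow> \<exists>y\<in>K. f y < f x"
    by (meson not_le)
  let ?U = "\<lambda>y. {x \<in> K. f y < f x}"
  have "openin (top_of_set K) (?U y)" for y
  proof (subst openin_subopen, intro ballI)
    fix x assume x: "x \<in> ?U y"
    then have "\<forall>\<^sub>F z in at x within K. f y < f z"
      using assms(1) unfolding lower_semicontinuous_on_def by auto
    then obtain S where S: "open S" "x \<in> S" "\<And>z. z \<in> S \<Longrightarrow> z \<noteq> x \<Longrightarrow> z \<in> K \<Longrightarrow> f y < f z"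
      unfolding eventually_at_topological by blast
    then have "openin (top_of_set K) (K \<inter> S)" "x \<in> K \<inter> S" "K \<inter> S \<subseteq> ?U y"
      using x by (auto simp: openin_open)
    then show "\<exists>V. openin (top_of_set K) V \<and> x \<in> V \<and> V \<subseteq> ?U y" by blast
  qed
  moreover have "K \<subseteq> \<Union> (?U ` K)"
    using cover by blast
  ultimately obtain D where "D \<subseteq> ?U ` K" "finite D" "K \<subseteq> \<Union> D"
    using assms(2) unfolding compact_eq_openin_cover by (metis (no_types, lifting) imageE)
  then obtain Y where Y: "Y \<subseteq> K" "finite Y" "K \<subseteq> \<Union> (?U ` Y)"
    by (metis (no_types, lifting) finite_subset_image)
  then have "Y \<noteq> {}" using assms(3) by auto
  then obtain y where y: "y \<in> Y" "\<And>z. z \<in> Y \<Longrightarrow> f y \<le> f z"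
    using ex_min_if_finite[of "f ` Y"] Y(2) by (metis (no_types, lifting) arg_min_if_finite(1) arg_min_least)
  then obtain z where "z \<in> Y" "f z < f y"
    using Y by blast
  with y show False by (meson not_le)
qed

lemma lower_semicontinuous_on_blinfun_add:
  fixes L :: "'v::real_normed_vector \<Rightarrow>\<^sub>L real"
  assumes "lower_semicontinuous_on K f" "a \<ge> 0"
  shows "lower_semicontinuous_on K (\<lambda>w. L w + a * f w)"
  unfolding lower_semicontinuous_on_def
proof (intro ballI allI impI)
  fix x c assume x: "x \<in> K" and c: "c < L x + a * f x"
  define e where "e = (L x + a * f x - c) / 2"
  have e: "e > 0" using c by (simp add: e_def)
  have "((\<lambda>w. L w) \<longlongrightarrow> L x) (at x within K)"
    by (intro tendsto_intros)
  then have L: "\<forall>\<^sub>F w in at x within K. L w > L x - e"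
    using e by (intro order_tendstoD) auto
  \<comment> \<open>Dividing by \<open>a + 1\<close> instead of \<open>a\<close> keeps the case
    \<open>a = 0\<close> inside the same argument.\<close>
  have "f x - e / (a + 1) < f x"
    using assms(2) e by (simp add: field_simps)
  then have "\<forall>\<^sub>F w in at x within K. f w > f x - e / (a + 1)"
    using assms(1) x unfolding lower_semicontinuous_on_def by blast
  then show "\<forall>\<^sub>F w in at x within K. c < L w + a * f w"
    using L
  proof eventually_elim
    case (elim w)
    have "a * f w \<ge> a * (f x - e / (a + 1))"
      using elim(1) assms(2) by (intro mult_left_mono) auto
    moreover have "a * (e / (a + 1)) \<le> e"
      using assms(2) e by (simp add: field_simps)
    ultimately have "a * f w \<ge> a * f x - e"
      by (simp add: right_diff_distrib)
    with elim(2) show ?case by (simp add: e_def field_simps)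
  qed
qed

lemma lower_semicontinuous_on_sequentially:
  assumes "lower_semicontinuous_on K f" "x \<in> K" "\<And>n. X n \<in> K" "X \<longlonglongrightarrow> x"
    and "\<And>n. f (X n) \<le> c"
  shows "f x \<le> c"
proof (rule ccontr)
  assume "\<not> f x \<le> c"
  then have "\<forall>\<^sub>F y in at x within K. c < f y" "c < f x"
    using assms(1,2) unfolding lower_semicontinuous_on_def by auto
  \<comment> \<open>The filter \<open>at x\<close> leaves out \<open>x\<close> itself;
    \<open>c < f x\<close> fills this gap, so terms of \<open>X\<close> equal to \<open>x\<close>
    are covered.\<close>
  then obtain S where "open S" "x \<in> S" "\<And>z. z \<in> S \<Longrightarrow> z \<in> K \<Longrightarrow> c < f z"
    unfolding eventually_at_topological by metis
  moreover from this have "\<forall>\<^sub>F n in sequentially. X n \<in> S"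
    using assms(4) topological_tendstoD by blast
  ultimately show False
    using assms(3,5) by (metis eventually_sequentially linorder_not_less order_refl)
qed

section \<open>Regularized minimization over \<open>K\<close>\<close>

locale ftrl =
  fixes K :: "'v::real_normed_vector set" and R :: "'v \<Rightarrow> real" and lam :: real
  assumes K_compact: "compact K" and K_ne: "K \<noteq> {}" and lam_pos: "lam > 0"
    and R_nonneg: "\<And>w. w \<in> K \<Longrightarrow> R w \<ge> 0"
    and R_lsc: "lower_semicontinuous_on K R"
    and R_strong: "strongly_convex_on lam K R"
begin

definition minimizes :: "real \<Rightarrow> ('v \<Rightarrow>\<^sub>L real) \<Rightarrow> 'v \<Rightarrow> bool" where
  "minimizes a L w \<longleftrightarrow> w \<in> K \<and> (\<forall>z\<in>K. L w + a * R w \<le> L z + a * R z)"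

text \<open>This is \<open>G a L\<close>. For \<open>a > 0\<close> it is minus \<open>a\<close>
  times the conjugate at \<open>- L / a\<close>, but it keeps its meaning at
  \<open>a = 0\<close>.\<close>

definition min_cost :: "real \<Rightarrow> ('v \<Rightarrow>\<^sub>L real) \<Rightarrow> real" where
  "min_cost a L = (INF w\<in>K. L w + a * R w)"

lemma ex_minimizes: "a \<ge> 0 \<Longrightarrow> \<exists>w. minimizes a L w"
  unfolding minimizes_def
  using lower_semicontinuous_on_attains_min[OF lower_semicontinuous_on_blinfun_add[OF R_lsc] K_compact K_ne]
  by blast

lemma min_cost_eq: "minimizes a L w \<Longrightarrow> min_cost a L = L w + a * R w"
  unfolding min_cost_def minimizes_def by (intro cInf_eq_minimum) auto

lemma min_cost_le: "a \<ge> 0 \<Longrightarrow> u \<in> K \<Longrightarrow> min_cost a L \<le> L u + a * R u"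
  using ex_minimizes[of a L] min_cost_eq unfolding minimizes_def by metis

text \<open>Since \<open>R\<close> is non-negative, the minimizer for \<open>b\<close> costs no more
  under the smaller coefficient \<open>a\<close>.\<close>

lemma min_cost_mono:
  assumes "0 \<le> a" "a \<le> b"
  shows "min_cost a L \<le> min_cost b L"
proof -
  obtain w where w: "minimizes b L w"
    using ex_minimizes[of b L] assms by auto
  then have "w \<in> K" by (simp add: minimizes_def)
  then have "min_cost a L \<le> L w + a * R w"
    using assms by (intro min_cost_le)
  also have "\<dots> \<le> L w + b * R w"
    using assms R_nonneg[OF \<open>w \<in> K\<close>] by (simp add: mult_right_mono)
  finally show ?thesis using min_cost_eq[OF w] by simp
qed

lemma min_cost_zero: "min_cost 0 0 = 0"
  using min_cost_eq ex_minimizes[of 0 0] by fastforce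

section \<open>Smoothness of the conjugate\<close>

lemma minimizes_iff_subgradient:
  assumes "a > 0"
  shows "minimizes a L w \<longleftrightarrow> w \<in> K \<and> is_subgradient K R w (- (L /\<^sub>R a))"
proof -
  have "R w + (- (L /\<^sub>R a)) (z - w) \<le> R z \<longleftrightarrow> L w + a * R w \<le> L z + a * R z" for z
    using assms
    by (simp add: blinfun.minus_left blinfun.scaleR_left blinfun.diff_right field_simps)
  then show ?thesis
    unfolding minimizes_def is_subgradient_def by simp
qed

lemma fenchel_conjugate_eq:
  assumes "w \<in> K" "is_subgradient K R w p"
  shows "fenchel_conjugate K R p = p w - R w"
  unfolding fenchel_conjugate_def
  using assms by (intro cSup_eq_maximum) (auto simp: is_subgradient_def blinfun.diff_right algebra_simps)

text \<open>Take a minimizer of \<open>R - p\<close>. It attains the supremum in the conjugate at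
  \<open>p\<close> and will be the gradient there.\<close>

lemma ex_subgradient: "\<exists>w\<in>K. is_subgradient K R w p"
  using ex_minimizes[of 1 "- p"] minimizes_iff_subgradient[of 1 "- p"] by auto

text \<open>Let \<open>v\<close> attain the supremum at \<open>q\<close>. The subgradient inequality
  at \<open>v\<close> makes the remainder non-negative; strong convexity at \<open>w\<close> bounds
  it by a concave quadratic in \<open>norm (v - w)\<close>.\<close>

lemma fenchel_conjugate_smooth:
  assumes w: "w \<in> K" "is_subgradient K R w p"
  shows "\<bar>fenchel_conjugate K R q - fenchel_conjugate K R p - (q - p) w\<bar> \<le> (norm (q - p))\<^sup>2 / (2 * lam)"
proof -
  obtain v where v: "v \<in> K" "is_subgradient K R v q"
    using ex_subgradient by blast
  let ?B = "fenchel_conjugate K R q - fenchel_conjugate K R p - (q - p) w"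
  have eq: "?B = q v - R v - p w + R w - (q - p) w"
    using fenchel_conjugate_eq v w by simp
  have "R w \<ge> R v + q (w - v)"
    using v w unfolding is_subgradient_def by blast
  then have "?B \<ge> 0"
    unfolding eq by (simp add: blinfun.diff_left blinfun.diff_right)
  have "R v \<ge> R w + p (v - w) + lam / 2 * (norm (w - v))\<^sup>2"
    using R_strong v w unfolding strongly_convex_on_def by blast
  then have "?B \<le> (q - p) (v - w) - lam / 2 * (norm (v - w))\<^sup>2"
    unfolding eq by (simp add: blinfun.diff_left blinfun.diff_right norm_minus_commute)
  also have "(q - p) (v - w) \<le> norm (q - p) * norm (v - w)"
    using norm_blinfun[of "q - p" "v - w"] by simp
  also have "norm (q - p) * norm (v - w) - lam / 2 * (norm (v - w))\<^sup>2 \<le> (norm (q - p))\<^sup>2 / (2 * lam)"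
  proof -
    \<comment> \<open>Completing the square gives the maximum of that quadratic.\<close>
    have "0 \<le> (norm (q - p) - lam * norm (v - w))\<^sup>2" by simp
    then show ?thesis
      using lam_pos by (simp add: field_simps power2_eq_square)
  qed
  finally show ?thesis using \<open>?B \<ge> 0\<close> by simp
qed

lemma fenchel_conjugate_has_derivative:
  assumes w: "w \<in> K" "is_subgradient K R w p"
  shows "(fenchel_conjugate K R has_derivative (\<lambda>h. blinfun_apply h w)) (at p)"
proof (rule has_derivativeI_sandwich[where e = 1 and H = "\<lambda>q. norm (q - p) / (2 * lam)"])
  show "bounded_linear (\<lambda>h. blinfun_apply h w)"
    by (rule blinfun.bounded_linear_left)
  have "((\<lambda>q. norm (q - p) / (2 * lam)) \<longlongrightarrow> norm (p - p) / (2 * lam)) (at p)"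
    using lam_pos by (intro tendsto_intros) auto
  then show "((\<lambda>q. norm (q - p) / (2 * lam)) \<longlongrightarrow> 0) (at p)" by simp
  fix q assume "q \<noteq> p"
  then show "norm (fenchel_conjugate K R q - fenchel_conjugate K R p - blinfun_apply (q - p) w)
      / norm (q - p) \<le> norm (q - p) / (2 * lam)"
    using fenchel_conjugate_smooth[OF w, of q] by (simp add: divide_le_eq power2_eq_square)
qed simp

lemma bregman_fenchel_conjugate:
  assumes "w \<in> K" "is_subgradient K R w p"
  shows "bregman (fenchel_conjugate K R) q p
    = fenchel_conjugate K R q - fenchel_conjugate K R p - (q - p) w"
  unfolding bregman_def frechet_derivative_at[OF fenchel_conjugate_has_derivative[OF assms], symmetric] ..

section \<open>Scaled Bregman divergences for a positive coefficient\<close>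

lemma scaled_fenchel_conjugate:
  assumes "a > 0"
  shows "a * fenchel_conjugate K R (- (L /\<^sub>R a)) = - min_cost a L"
proof -
  obtain w where w: "minimizes a L w"
    using ex_minimizes[of a L] assms by auto
  then have "fenchel_conjugate K R (- (L /\<^sub>R a)) = (- (L /\<^sub>R a)) w - R w"
    using minimizes_iff_subgradient[OF assms] fenchel_conjugate_eq by blast
  then show ?thesis
    using assms min_cost_eq[OF w]
    by (simp add: blinfun.minus_left blinfun.scaleR_left field_simps)
qed

text \<open>The factor \<open>a\<close> cancels the divisions by \<open>a\<close>: conjugate values
  turn into \<open>- min_cost\<close>, and the gradient term pairs \<open>L - L'\<close> with
  \<open>w\<close>. The resulting expression also makes sense at \<open>a = 0\<close>.\<close>

lemma scaled_bregman_pos: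
  assumes "a > 0" "minimizes a L' w"
  shows "a * bregman (fenchel_conjugate K R) (- (L /\<^sub>R a)) (- (L' /\<^sub>R a))
    = min_cost a L' - min_cost a L + (L - L') w"
proof -
  have "a * bregman (fenchel_conjugate K R) (- (L /\<^sub>R a)) (- (L' /\<^sub>R a))
    = a * fenchel_conjugate K R (- (L /\<^sub>R a)) - a * fenchel_conjugate K R (- (L' /\<^sub>R a))
      - a * (- (L /\<^sub>R a) - - (L' /\<^sub>R a)) w"
    using assms(2) unfolding minimizes_iff_subgradient[OF assms(1)]
    by (subst bregman_fenchel_conjugate) (simp_all only: right_diff_distrib)
  also have "a * (- (L /\<^sub>R a) - - (L' /\<^sub>R a)) w = - (L - L') w"
    using assms(1)
    by (simp add: blinfun.minus_left blinfun.diff_left blinfun.add_left blinfun.scaleR_left field_simps)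
  finally show ?thesis
    using assms(1) by (simp add: scaled_fenchel_conjugate)
qed

text \<open>The arguments differ by \<open>norm (L - L') / a\<close>, so the quadratic smoothness
  bound exactly absorbs both factors \<open>a\<close>.\<close>

lemma scaled_bregman_pos_le:
  assumes "a > 0"
  shows "a * (a * bregman (fenchel_conjugate K R) (- (L /\<^sub>R a)) (- (L' /\<^sub>R a)))
    \<le> (norm (L - L'))\<^sup>2 / (2 * lam)"
proof -
  obtain w where w: "w \<in> K" "is_subgradient K R w (- (L' /\<^sub>R a))"
    using ex_subgradient by blast
  have "- (L /\<^sub>R a) - - (L' /\<^sub>R a) = - ((L - L') /\<^sub>R a)"
    by (simp add: scaleR_diff_right)
  then have n: "norm (- (L /\<^sub>R a) - - (L' /\<^sub>R a)) = norm (L - L') / a"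
    using assms by (simp add: divide_inverse mult.commute)
  have "bregman (fenchel_conjugate K R) (- (L /\<^sub>R a)) (- (L' /\<^sub>R a)) \<le> (norm (L - L') / a)\<^sup>2 / (2 * lam)"
    using fenchel_conjugate_smooth[OF w, of "- (L /\<^sub>R a)"]
    unfolding bregman_fenchel_conjugate[OF w] n by linarith
  then have "a\<^sup>2 * bregman (fenchel_conjugate K R) (- (L /\<^sub>R a)) (- (L' /\<^sub>R a))
      \<le> a\<^sup>2 * ((norm (L - L') / a)\<^sup>2 / (2 * lam))"
    by (intro mult_left_mono) auto
  then show ?thesis
    using assms by (simp add: power2_eq_square mult.assoc)
qed

section \<open>Predictions and the limit of a vanishing coefficient\<close>

lemma ftrl_prediction_zero:
  "is_arg_min R (minimizes 0 L) (ftrl_prediction K R 0 L)"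
proof -
  have set: "{w. is_arg_min (blinfun_apply L) (\<lambda>v. v \<in> K) w} = {w. minimizes 0 L w}"
    by (auto simp: is_arg_min_linorder minimizes_def)
  obtain v where v: "minimizes 0 L v"
    using ex_minimizes by blast
  then have F: "{w. minimizes 0 L w} = K \<inter> {w. L w \<le> L v}"
    by (auto simp: minimizes_def intro: order_trans)
  have "closed {w. L w \<le> L v}"
    by (intro closed_Collect_le continuous_intros)
  \<comment> \<open>On this compact set \<open>R\<close> attains its least value, so the choice made
    by \<open>ftrl_prediction\<close> is a genuine minimizer.\<close>
  then have "compact {w. minimizes 0 L w}"
    unfolding F using K_compact by (rule compact_Int_closed[rotated])
  then obtain x where "minimizes 0 L x" "\<And>y. minimizes 0 L y \<Longrightarrow> R x \<le> R y"
    using lower_semicontinuous_on_attains_min[OF lower_semicontinuous_on_subset[OF R_lsc]] F v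
    by (metis (no_types, lifting) Int_lower1 empty_iff mem_Collect_eq)
  then have "\<exists>x. is_arg_min R (minimizes 0 L) x"
    by (auto simp: is_arg_min_linorder)
  then show ?thesis
    unfolding ftrl_prediction_def set arg_min_on_def arg_min_def by (simp add: someI_ex)
qed

lemma minimizes_ftrl_prediction:
  assumes "a \<ge> 0"
  shows "minimizes a L (ftrl_prediction K R a L)"
proof (cases "a = 0")
  case True
  then show ?thesis
    using ftrl_prediction_zero by (simp add: is_arg_min_def)
next
  case False
  have "\<exists>x. is_arg_min (\<lambda>w. L w + a * R w) (\<lambda>w. w \<in> K) x"
    using ex_minimizes[OF assms, of L] by (auto simp: minimizes_def is_arg_min_linorder)
  then have "is_arg_min (\<lambda>w. L w + a * R w) (\<lambda>w. w \<in> K) (ftrl_prediction K R a L)"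
    using False unfolding ftrl_prediction_def arg_min_on_def arg_min_def by (simp add: someI_ex)
  then show ?thesis by (simp add: minimizes_def is_arg_min_linorder)
qed

text \<open>Squeezed between its value at 0 and the cost of a fixed minimizer of \<open>L\<close>,
  which is affine in \<open>b\<close>.\<close>

lemma min_cost_tendsto_zero: "((\<lambda>b. min_cost b L) \<longlongrightarrow> min_cost 0 L) (at_right 0)"
proof -
  obtain w where w: "minimizes 0 L w"
    using ex_minimizes by blast
  show ?thesis
  proof (rule tendsto_sandwich)
    show "\<forall>\<^sub>F b in at_right 0. min_cost 0 L \<le> min_cost b L"
      using eventually_at_right_less[of 0] by eventually_elim (simp add: min_cost_mono)
    show "\<forall>\<^sub>F b in at_right 0. min_cost b L \<le> L w + b * R w"
      using eventually_at_right_less[of 0]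
      by eventually_elim (use w in \<open>simp add: min_cost_le minimizes_def\<close>)
    have "((\<lambda>b. L w + b * R w) \<longlongrightarrow> L w + 0 * R w) (at_right 0)"
      by (intro tendsto_intros)
    then show "((\<lambda>b. L w + b * R w) \<longlongrightarrow> min_cost 0 L) (at_right 0)"
      using min_cost_eq[OF w] by simp
  qed simp
qed

text \<open>\<open>R\<close> need not have a subgradient at \<open>v\<close>; strong convexity is used at \<open>W b\<close> instead, and
  a cluster point of \<open>W\<close> other than \<open>v\<close> would minimize \<open>L\<close> with a smaller value of \<open>R\<close>.\<close>

lemma minimizes_tendsto_zero:
  assumes W: "\<And>b. b > 0 \<Longrightarrow> minimizes b L (W b)" and v: "is_arg_min R (minimizes 0 L) v"
  shows "(W \<longlongrightarrow> v) (at_right 0)"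
  unfolding tendsto_iff
proof (intro allI impI)
  fix e :: real assume e: "e > 0"
  have vK: "v \<in> K" "minimizes 0 L v"
    using v by (auto simp: is_arg_min_def minimizes_def)
  have gap: "R (W b) + lam / 2 * (norm (W b - v))\<^sup>2 \<le> R v" if b: "b > 0" for b
  proof -
    have "W b \<in> K" "is_subgradient K R (W b) (- (L /\<^sub>R b))"
      using W[OF b] minimizes_iff_subgradient[OF b] by auto
    then have "R v \<ge> R (W b) + (- (L /\<^sub>R b)) (v - W b) + lam / 2 * (norm (W b - v))\<^sup>2"
      using R_strong vK unfolding strongly_convex_on_def by blast
    \<comment> \<open>Since \<open>v\<close> minimizes \<open>L\<close>, moving from
      \<open>W b\<close> to \<open>v\<close> cannot increase \<open>L\<close>; hence the gap is
      uniform in \<open>b\<close>.\<close>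
    moreover have "(- (L /\<^sub>R b)) (v - W b) \<ge> 0"
      using vK \<open>W b \<in> K\<close> b
      by (simp add: minimizes_def blinfun.minus_left blinfun.scaleR_left blinfun.diff_right field_simps)
    ultimately show ?thesis by linarith
  qed
  show "\<forall>\<^sub>F b in at_right 0. dist (W b) v < e"
  proof (rule sequentially_imp_eventually_at_right[of 0 1])
    fix f :: "nat \<Rightarrow> real"
    assume f: "\<And>n. 0 < f n" "f \<longlonglongrightarrow> 0"
    show "\<forall>\<^sub>F n in sequentially. dist (W (f n)) v < e"
    proof (rule ccontr)
      assume "\<not> ?thesis"
      then obtain r :: "nat \<Rightarrow> nat" where r: "strict_mono r" "\<And>n. \<not> dist (W (f (r n))) v < e"
        using not_eventually_sequentiallyD[of "\<lambda>n. dist (W (f n)) v < e"] by blast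
      have "\<forall>n. W (f (r n)) \<in> K"
        using W f(1) by (simp add: minimizes_def)
      moreover have "seq_compact K"
        using K_compact by (simp add: compact_eq_seq_compact_metric)
      ultimately obtain x s where x: "x \<in> K" "strict_mono s" "((\<lambda>n. W (f (r n))) \<circ> s) \<longlonglongrightarrow> x"
        using seq_compactE[of K "\<lambda>n. W (f (r n))"] by metis
      define g where "g = (\<lambda>n. f (r (s n)))"
      have g: "g \<longlonglongrightarrow> 0" "\<And>n. g n > 0"
        using LIMSEQ_subseq_LIMSEQ[OF f(2) strict_mono_o[OF r(1) x(2)]] f(1)
        by (simp_all add: g_def o_def)
      have Wg: "(\<lambda>n. W (g n)) \<longlonglongrightarrow> x" "\<And>n. W (g n) \<in> K"
        using x(3) W g(2) by (simp_all add: g_def o_def minimizes_def)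
      \<comment> \<open>Staying at distance \<open>e\<close> from \<open>v\<close> costs a fixed
        amount of \<open>R\<close>, which survives in the limit by lower semicontinuity.\<close>
      have "R (W (g n)) \<le> R v - lam / 2 * e\<^sup>2" for n
      proof -
        have "e\<^sup>2 \<le> (norm (W (g n) - v))\<^sup>2"
          using r(2)[of "s n"] e by (intro power_mono) (auto simp: g_def dist_norm)
        then have "lam / 2 * e\<^sup>2 \<le> lam / 2 * (norm (W (g n) - v))\<^sup>2"
          using lam_pos by (intro mult_left_mono) auto
        with gap[OF g(2)[of n]] show ?thesis by linarith
      qed
      then have "R x \<le> R v - lam / 2 * e\<^sup>2"
        by (rule lower_semicontinuous_on_sequentially[OF R_lsc x(1) Wg(2,1)])
      then have "R x < R v"
        using lam_pos e by (smt (verit) divide_pos_pos mult_pos_pos zero_less_power)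
      have "L x \<le> L v"
      proof (rule LIMSEQ_le)
        show "(\<lambda>n. L (W (g n))) \<longlonglongrightarrow> L x"
          using Wg(1) by (intro tendsto_intros)
        have "(\<lambda>n. L v + g n * R v) \<longlonglongrightarrow> L v + 0 * R v"
          using g(1) by (intro tendsto_intros)
        then show "(\<lambda>n. L v + g n * R v) \<longlonglongrightarrow> L v" by simp
        have "L (W (g n)) \<le> L v + g n * R v" for n
        proof -
          have "L (W (g n)) + g n * R (W (g n)) \<le> L v + g n * R v"
            using W[OF g(2)] vK(1) by (simp add: minimizes_def)
          moreover have "g n * R (W (g n)) \<ge> 0"
            using g(2)[of n] R_nonneg[OF Wg(2)] by simp
          ultimately show ?thesis by linarith
        qed
        then show "\<exists>N. \<forall>n\<ge>N. L (W (g n)) \<le> L v + g n * R v" by blast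
      qed
      then have "minimizes 0 L x"
        using vK x(1) unfolding minimizes_def by fastforce
      with v \<open>R x < R v\<close> show False
        by (simp add: is_arg_min_def)
    qed
  qed simp
qed

section \<open>The increment formula and its two upper bounds\<close>

lemma scaled_bregman_eq:
  assumes "a \<ge> 0"
  shows "scaled_bregman (fenchel_conjugate K R) a L L'
    = min_cost a L' - min_cost a L + (L - L') (ftrl_prediction K R a L')"
proof (cases "a = 0")
  case False
  then show ?thesis
    using assms scaled_bregman_pos[OF _ minimizes_ftrl_prediction] by (simp add: scaled_bregman_def)
next
  case True
  define W where "W b = ftrl_prediction K R b L'" for b
  have W: "minimizes b L' (W b)" if "b > 0" for b
    unfolding W_def using that by (intro minimizes_ftrl_prediction) simp
  \<comment> \<open>Breaking ties by the smallest \<open>R\<close> makes the prediction at 0 the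
    limit of those at \<open>b\<close>, so the formula for \<open>b > 0\<close> passes to the limit
    term by term.\<close>
  have "(W \<longlongrightarrow> W 0) (at_right 0)"
    using W ftrl_prediction_zero unfolding W_def[of 0] by (rule minimizes_tendsto_zero)
  then have "((\<lambda>b. min_cost b L' - min_cost b L + (L - L') (W b))
      \<longlongrightarrow> min_cost 0 L' - min_cost 0 L + (L - L') (W 0)) (at_right 0)"
    by (intro tendsto_intros min_cost_tendsto_zero)
  moreover have "\<forall>\<^sub>F b in at_right 0. min_cost b L' - min_cost b L + (L - L') (W b)
      = b * bregman (fenchel_conjugate K R) (- (L /\<^sub>R b)) (- (L' /\<^sub>R b))"
    using eventually_at_right_less[of 0] by eventually_elim (simp add: scaled_bregman_pos[OF _ W])
  ultimately have "((\<lambda>b. b * bregman (fenchel_conjugate K R) (- (L /\<^sub>R b)) (- (L' /\<^sub>R b)))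
      \<longlongrightarrow> min_cost 0 L' - min_cost 0 L + (L - L') (W 0)) (at_right 0)"
    by (rule Lim_transform_eventually)
  then show ?thesis
    using True tendsto_Lim[OF trivial_limit_at_right_real] by (simp add: scaled_bregman_def W_def)
qed

text \<open>By the increment formula, this is the excess of the cost of the old minimizer
  \<open>?w\<close> under \<open>L\<close> over the least such cost.\<close>

lemma scaled_bregman_nonneg:
  assumes "a \<ge> 0"
  shows "scaled_bregman (fenchel_conjugate K R) a L L' \<ge> 0"
proof -
  let ?w = "ftrl_prediction K R a L'"
  have w: "minimizes a L' ?w"
    using assms by (rule minimizes_ftrl_prediction)
  then have "min_cost a L \<le> L ?w + a * R ?w"
    using assms by (intro min_cost_le) (auto simp: minimizes_def)
  then show ?thesis
    using min_cost_eq[OF w] by (simp add: scaled_bregman_eq[OF assms] blinfun.diff_left)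
qed

text \<open>Testing the old problem with the new minimizer \<open>v\<close> cancels the regularizer
  and leaves \<open>L - L'\<close> applied to a difference of two points of
  \<open>K\<close>.\<close>

lemma scaled_bregman_le_diameter:
  assumes "a \<ge> 0"
  shows "scaled_bregman (fenchel_conjugate K R) a L L' \<le> diameter K * norm (L - L')"
proof -
  let ?w = "ftrl_prediction K R a L'"
  obtain v where v: "minimizes a L v"
    using ex_minimizes[OF assms] by blast
  have K: "?w \<in> K" "v \<in> K"
    using v minimizes_ftrl_prediction[OF assms, of L'] by (auto simp: minimizes_def)
  have "scaled_bregman (fenchel_conjugate K R) a L L' \<le> (L - L') (?w - v)"
    using min_cost_le[OF assms K(2), of L'] min_cost_eq[OF v]
    by (simp add: scaled_bregman_eq[OF assms] blinfun.diff_left blinfun.diff_right)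
  also have "\<dots> \<le> norm (L - L') * norm (?w - v)"
    using norm_blinfun[of "L - L'" "?w - v"] by simp
  also have "\<dots> \<le> norm (L - L') * diameter K"
    using diameter_bounded_bound[OF compact_imp_bounded[OF K_compact] K]
    by (intro mult_left_mono) (auto simp: dist_norm)
  finally show ?thesis by (simp add: mult.commute)
qed

lemma mult_scaled_bregman_le:
  assumes "a \<ge> 0"
  shows "a * scaled_bregman (fenchel_conjugate K R) a L L' \<le> (norm (L - L'))\<^sup>2 / (2 * lam)"
  using assms lam_pos scaled_bregman_pos_le[of a L L'] by (cases "a = 0") (auto simp: scaled_bregman_def)

section \<open>Growth of \<open>delta\<close> and the regret bound\<close>

context
  fixes l :: "nat \<Rightarrow> 'v \<Rightarrow>\<^sub>L real"
begin

abbreviation "delta \<equiv> ada_delta K R l"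
text \<open>Indices are shifted: \<open>incr t\<close> is what round \<open>Suc t\<close> adds to
  \<open>delta t\<close>.\<close>

abbreviation "incr t \<equiv>
  scaled_bregman (fenchel_conjugate K R) (delta t) (cum_loss l (Suc t)) (cum_loss l t)"

lemma cum_loss_Suc: "cum_loss l (Suc t) = cum_loss l t + l (Suc t)"
  by (simp add: cum_loss_def)

lemma ada_delta_0: "delta 0 = 0"
  by (subst ada_delta.simps) simp

lemma ada_delta_Suc: "delta (Suc t) = delta t + incr t"
proof -
  have "delta (Suc t) = (\<Sum>i\<in>{1..t}. scaled_bregman (fenchel_conjugate K R) (delta (i - 1))
      (cum_loss l i) (cum_loss l (i - 1))) + incr t"
    by (subst ada_delta.simps) simp
  then show ?thesis
    by (simp only: ada_delta.simps[of K R l t, symmetric])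
qed

lemma ada_delta_nonneg: "delta t \<ge> 0"
  by (induction t) (auto simp: ada_delta_0 ada_delta_Suc scaled_bregman_nonneg)

lemma sum_loss_adaftrl_le:
  "(\<Sum>t\<in>{1..T}. (l t) (adaftrl K R l t)) \<le> delta T + min_cost (delta T) (cum_loss l T)"
proof (induction T)
  case 0
  then show ?case by (simp add: ada_delta_0 cum_loss_def min_cost_zero)
next
  case (Suc T)
  have "(l (Suc T)) (adaftrl K R l (Suc T))
      = incr T - min_cost (delta T) (cum_loss l T) + min_cost (delta T) (cum_loss l (Suc T))"
    by (simp add: scaled_bregman_eq ada_delta_nonneg adaftrl_def cum_loss_Suc)
  \<comment> \<open>The increment formula keeps the coefficient \<open>delta T\<close>; monotonicity
    passes to \<open>delta (Suc T)\<close> so that the sum telescopes.\<close>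
  moreover have "min_cost (delta T) (cum_loss l (Suc T)) \<le> min_cost (delta (Suc T)) (cum_loss l (Suc T))"
    by (intro min_cost_mono) (simp_all add: ada_delta_nonneg ada_delta_Suc scaled_bregman_nonneg)
  ultimately show ?case
    using Suc.IH by (simp add: ada_delta_Suc)
qed

text \<open>Testing \<open>min_cost\<close> with \<open>u\<close> produces the cumulative loss of
  \<open>u\<close>, which cancels, and the term \<open>delta T * R u\<close>.\<close>

lemma regret_adaftrl_le:
  assumes "u \<in> K"
  shows "regret l (adaftrl K R l) T u \<le> delta T * (1 + R u)"
proof -
  have "(\<Sum>t\<in>{1..T}. (l t) u) = cum_loss l T u"
    by (simp add: cum_loss_def blinfun.sum_left)
  then show ?thesis
    using sum_loss_adaftrl_le[of T] min_cost_le[OF ada_delta_nonneg[of T] assms, of "cum_loss l T"]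
    by (simp add: regret_def algebra_simps)
qed

text \<open>The factor 3 counts the cross term of the square twice, bounded through
  \<open>1 / (2 * lam)\<close>, and the squared increment once, bounded through the
  diameter.\<close>

lemma ada_delta_square_le:
  assumes c: "(diameter K)\<^sup>2 \<le> C" "1 / (2 * lam) \<le> C"
  shows "(delta T)\<^sup>2 \<le> 3 * C * (\<Sum>t\<in>{1..T}. (norm (l t))\<^sup>2)"
proof (induction T)
  case 0
  then show ?case by (simp add: ada_delta_0)
next
  case (Suc T)
  let ?n = "norm (l (Suc T))"
  have "delta T * incr T \<le> ?n\<^sup>2 / (2 * lam)"
    using mult_scaled_bregman_le[OF ada_delta_nonneg] by (metis add_diff_cancel_left' cum_loss_Suc)
  also have "\<dots> \<le> C * ?n\<^sup>2"
    using mult_right_mono[OF c(2), of "?n\<^sup>2"] by simp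
  finally have cross: "delta T * incr T \<le> C * ?n\<^sup>2" .
  have "incr T \<le> diameter K * ?n"
    using scaled_bregman_le_diameter[OF ada_delta_nonneg] by (metis add_diff_cancel_left' cum_loss_Suc)
  then have "(incr T)\<^sup>2 \<le> (diameter K * ?n)\<^sup>2"
    by (intro power_mono scaled_bregman_nonneg ada_delta_nonneg)
  also have "\<dots> \<le> C * ?n\<^sup>2"
    using mult_right_mono[OF c(1), of "?n\<^sup>2"] by (simp add: power_mult_distrib)
  finally have "(delta T)\<^sup>2 + 2 * (delta T * incr T) + (incr T)\<^sup>2
      \<le> 3 * C * (\<Sum>t\<in>{1..T}. (norm (l t))\<^sup>2) + 2 * (C * ?n\<^sup>2) + C * ?n\<^sup>2"
    using Suc.IH cross by linarith
  then show ?case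
    by (simp add: ada_delta_Suc power2_sum algebra_simps)
qed

end

end

theorem theorem1:
  fixes K :: "'v::real_normed_vector set"
    and R :: "'v \<Rightarrow> real"
    and lam :: real
    and l :: "nat \<Rightarrow> 'v \<Rightarrow>\<^sub>L real"
    and T :: nat
    and u :: 'v
  assumes "finite_dimensional TYPE('v)"
    and "K \<noteq> {}" and "bounded K" and "closed K" and "convex K"
    and "lam > 0"
    and "\<And>w. w \<in> K \<Longrightarrow> R w \<ge> 0"
    and "lower_semicontinuous_on K R"
    and "strongly_convex_on lam K R"
    and "bdd_above (R ` K)"
    and "u \<in> K"
  shows "regret l (adaftrl K R l) T u
    \<le> sqrt 3 * max (diameter K) (1 / sqrt (2 * lam))
        * sqrt (\<Sum>t\<in>{1..T}. (norm (l t))\<^sup>2) * (1 + R u)"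
proof -
  interpret ftrl K R lam
    using finite_dimensional_compact[OF assms(1,3,4)] assms(2,6-9) by unfold_locales
  define c where "c = max (diameter K) (1 / sqrt (2 * lam))"
  have "c \<ge> 0" "diameter K \<ge> 0"
    using assms(3) diameter_ge_0 by (auto simp: c_def le_max_iff_disj)
  then have "(diameter K)\<^sup>2 \<le> c\<^sup>2"
    unfolding c_def by (intro power_mono) auto
  moreover have "(1 / sqrt (2 * lam))\<^sup>2 \<le> c\<^sup>2"
    using assms(6) unfolding c_def by (intro power_mono) auto
  then have "1 / (2 * lam) \<le> c\<^sup>2"
    using assms(6) by (simp add: power_divide)
  \<comment> \<open>The square of the maximum \<open>c\<close> dominates both constants at
    once.\<close>
  ultimately have "(ada_delta K R l T)\<^sup>2 \<le> 3 * c\<^sup>2 * (\<Sum>t\<in>{1..T}. (norm (l t))\<^sup>2)"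
    by (rule ada_delta_square_le)
  then have "ada_delta K R l T \<le> sqrt (3 * c\<^sup>2 * (\<Sum>t\<in>{1..T}. (norm (l t))\<^sup>2))"
    by (rule real_le_rsqrt)
  also have "\<dots> = sqrt 3 * c * sqrt (\<Sum>t\<in>{1..T}. (norm (l t))\<^sup>2)"
    using \<open>c \<ge> 0\<close> by (simp add: real_sqrt_mult)
  finally have "ada_delta K R l T * (1 + R u)
      \<le> sqrt 3 * c * sqrt (\<Sum>t\<in>{1..T}. (norm (l t))\<^sup>2) * (1 + R u)"
    using assms(7)[OF assms(11)] by (intro mult_right_mono) auto
  with regret_adaftrl_le[OF assms(11)] show ?thesis
    unfolding c_def by (rule order_trans)
qed

end
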